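(* Let $t,g\ge 1$ be integers, let $\epsilon>0$, and let $I$ be a positive integer (the number of generators). Let $\phi(\gamma;\theta)$, $\Phi$, $\widetilde\Phi$, $w^*$, $q^*$, $h_i$, $\breve{\mathsf{cl}}\,h_i$, $\Delta_\theta^{\mathsf{minimax}}$ and $\Delta_\theta^{\mathsf{maximin}}$ be as defined in the context, with discriminator parameter $\theta\in\mathbb{R}^t$ and generator parameters $\gamma_1,\dots,\gamma_I\in\mathbb{R}^g$. Let $\Delta_\gamma^i:=\sup_{\mathbf{u}\in\mathbb{R}^t}\{h_i(\mathbf{u})-\breve{\mathsf{cl}}\,h_i(\mathbf{u})\}\ge 0$ and $\Delta_\gamma^{\mathsf{worst}}:=\max_{1\le i\le I}\Delta_\gamma^i$. Suppose that, for every $i$, $h_i$ is continuous and $\mathsf{dom}\,h_i$ is compact and convex. If $$I>\frac{t+1}{\epsilon}\,\Delta_\gamma^{\mathsf{worst}},$$ then $$0\le w^*-q^*\le \Delta_\theta^{\mathsf{minimax}}+\Delta_\theta^{\mathsf{maximin}}+\epsilon .$$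
   Context: Payoff. $\mathcal{P}_d$ is the data distribution, $\mathcal{P}_z$ a noise distribution, $D_\theta(\mathbf{x})$ (the output probability of the discriminator, in $[0,1]$) is parametrized by $\theta\in\mathbb{R}^t$, $G_\gamma(\mathbf{z})$ (the generator) is parametrized by $\gamma\in\mathbb{R}^g$, and $f$ is a concave increasing function. Define $$\phi(\gamma;\theta):=\mathbb{E}_{\mathbf{x}\sim\mathcal{P}_d} f(D_\theta(\mathbf{x}))+\mathbb{E}_{\mathbf{z}\sim\mathcal{P}_z} f(1-D_\theta(G_\gamma(\mathbf{z}))),\qquad \Phi(\gamma_1,\dots,\gamma_I;\theta):=\sum_{i=1}^I\phi(\gamma_i;\theta).$$ Minimax and maximin values. $$w^*:=\inf_{\gamma_1,\dots,\gamma_I\in\mathbb{R}^g}\sup_{\theta\in\mathbb{R}^t}\tfrac1I\Phi(\gamma_1,\dots,\gamma_I;\theta),\qquad q^*:=\sup_{\theta\in\mathbb{R}^t}\inf_{\gamma_1,\dots,\gamma_I\in\mathbb{R}^g}\tfrac1I\Phi(\gamma_1,\dots,\gamma_I;\theta).$$ Convex closure. For a function $F$, $F^*(\mathbf{v}):=\sup_{\mathbf{u}}\{\mathbf{u}^T\mathbf{v}-F(\mathbf{u})\}$ is its conjugate; the convex closure $\breve{\mathsf{cl}}F$ is the function whose epigraph is the closed convex hull of the epigraph of $F$; and $\widehat{\mathsf{cl}}F:=-\breve{\mathsf{cl}}(-F)$. Functions $h_i$. $h_i(\mathbf{u}_i):=\inf_{\gamma_i\in\mathbb{R}^g}(-\phi(\gamma_i;\cdot))^*(\mathbf{u}_i)$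 for $\mathbf{u}_i\in\mathbb{R}^t$, the conjugate being taken in the second argument $\theta$; $\mathsf{dom}\,h_i$ is the set where $h_i<+\infty$, and continuity of $h_i$ means continuity on $\mathsf{dom}\,h_i$. Its convex closure is $$\breve{\mathsf{cl}}\,h_i(\widetilde{\mathbf{u}}):=\inf_{\{a^j\},\{\mathbf{u}_i^j\}}\Big\{\sum_{j=1}^{t+2}a^jh_i(\mathbf{u}_i^j):\ \widetilde{\mathbf{u}}=\sum_{j=1}^{t+2}a^j\mathbf{u}_i^j,\ \sum_{j=1}^{t+2}a^j=1,\ a^j\ge0\Big\}.$$ In $\Delta_\gamma^i$ the difference is read as $0$ at points outside $\mathsf{dom}\,h_i$, where both functions are $+\infty$. Discriminator non-concavity. Let $\widetilde\Phi(\gamma_1,\dots,\gamma_I;\theta):=\sum_{i=1}^I\widehat{\mathsf{cl}}\,\phi(\gamma_i;\theta)$, where $-\widehat{\mathsf{cl}}\,\phi(\gamma_i;\theta)$ is the convex closure of $-\phi(\gamma_i;\theta)$ with respect to $\theta$. Define $$\Delta_\theta^{\mathsf{minimax}}:=\inf_{\gamma_1,\dots,\gamma_I}\sup_\theta\tfrac1I\Phi-\inf_{\gamma_1,\dots,\gamma_I}\sup_\theta\tfrac1I\widetilde\Phi,\qquad \Delta_\theta^{\mathsf{maximin}}:=\sup_\theta\inf_{\gamma_1,\dots,\gamma_I}\tfrac1I\widetilde\Phi-\sup_\theta\inf_{\gamma_1,\dots,\gamma_I}\tfrac1I\Phi,$$ with $\theta$ ranging over $\mathbb{R}^t$ and each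 $\gamma_i$ over $\mathbb{R}^g$. *)

theory Defs
  imports "HOL-Analysis.Analysis" "HOL-Probability.Probability"
begin

text \<open>
  Payoffs are extended-real valued, so that \<open>f\<close> may take the value \<open>-\<infinity>\<close>
  (as \<open>f = log\<close> does at \<open>0\<close>). Recall that on \<^typ>\<open>ereal\<close> we have \<open>0 * \<infinity> = 0\<close> and
  \<open>\<infinity> + -\<infinity> = \<infinity>\<close>, hence also \<open>-\<infinity> - -\<infinity> = \<infinity>\<close>.
\<close>

subsection \<open>Extended-real convex analysis\<close>

definition concave_on_ereal :: "real set \<Rightarrow> (real \<Rightarrow> ereal) \<Rightarrow> bool" where
  "concave_on_ereal S f \<longleftrightarrow> convex S \<and> (\<forall>x\<in>S. f x < \<infinity>) \<and>
     (\<forall>x\<in>S. \<forall>y\<in>S. \<forall>s\<in>{0..1}.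
        ereal (1 - s) * f x + ereal s * f y \<le> f ((1 - s) * x + s * y))"

definition epigraph :: "('a::euclidean_space \<Rightarrow> ereal) \<Rightarrow> ('a \<times> real) set" where
  "epigraph F = {(x, r). F x \<le> ereal r}"

definition conjugate :: "('a::euclidean_space \<Rightarrow> ereal) \<Rightarrow> 'a \<Rightarrow> ereal" where
  "conjugate F v = (SUP u. ereal (u \<bullet> v) - F u)"

text \<open>The lemma \<open>epigraph_convex_closure\<close> below shows that this is the function whose
  epigraph is the closed convex hull of the epigraph of \<open>F\<close>.\<close>

definition convex_closure :: "('a::euclidean_space \<Rightarrow> ereal) \<Rightarrow> 'a \<Rightarrow> ereal" where
  "convex_closure F x = (INF r \<in> {r. (x, r) \<in> closure (convex hull (epigraph F))}. ereal r)"

definition concave_closure :: "('a::euclidean_space \<Rightarrow> ereal) \<Rightarrow> 'a \<Rightarrow> ereal" where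
  "concave_closure F x = - convex_closure (\<lambda>y. - F y) x"

definition edom :: "('a \<Rightarrow> ereal) \<Rightarrow> 'a set" where
  "edom F = {x. F x < \<infinity>}"

lemma convex_hull_epigraph_upward:
  assumes "(x, r) \<in> convex hull (epigraph F)" "r \<le> s"
  shows "(x, s) \<in> convex hull (epigraph F)"
proof -
  let ?E = "epigraph F"
  have "(\<lambda>p. p + (0, s - r)) ` ?E \<subseteq> ?E"
  proof
    fix q assume "q \<in> (\<lambda>p. p + (0, s - r)) ` ?E"
    then obtain y u where q: "q = (y, u + (s - r))" and y: "F y \<le> ereal u"
      by (auto simp: epigraph_def)
    have "ereal u \<le> ereal (u + (s - r))" using assms(2) by simp
    with y have "F y \<le> ereal (u + (s - r))" by (rule order_trans)
    then show "q \<in> ?E" by (simp add: epigraph_def q)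
  qed
  then have "convex hull ((\<lambda>p. p + (0, s - r)) ` ?E) \<subseteq> convex hull ?E"
    by (rule hull_mono)
  moreover have "convex hull ((\<lambda>p. p + (0, s - r)) ` ?E) = (\<lambda>p. p + (0, s - r)) ` (convex hull ?E)"
    using convex_hull_translation[of "(0, s - r)" ?E] by (simp add: add.commute)
  moreover have "(x, s) \<in> (\<lambda>p. p + (0, s - r)) ` (convex hull ?E)"
    using assms(1) by (intro image_eqI[of _ _ "(x, r)"]) auto
  ultimately show ?thesis by blast
qed

lemma closed_convex_hull_epigraph_upward:
  assumes "(x, r) \<in> closure (convex hull (epigraph F))" "r \<le> s"
  shows "(x, s) \<in> closure (convex hull (epigraph F))"
proof -
  obtain p where p: "\<And>n. p n \<in> convex hull (epigraph F)" "p \<longlonglongrightarrow> (x, r)"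
    using assms(1) unfolding closure_sequential by blast
  have "p n + (0, s - r) \<in> convex hull (epigraph F)" for n
  proof -
    obtain y u where y: "p n = (y, u)" by (cases "p n")
    then have "(y, u + (s - r)) \<in> convex hull (epigraph F)"
      using p(1)[of n] assms(2) convex_hull_epigraph_upward[of y u F "u + (s - r)"] by simp
    then show ?thesis by (simp add: y)
  qed
  moreover have "(\<lambda>n. p n + (0, s - r)) \<longlonglongrightarrow> (x, r) + (0, s - r)"
    by (intro tendsto_add p(2) tendsto_const)
  ultimately have "(x, r) + (0, s - r) \<in> closure (convex hull (epigraph F))"
    unfolding closure_sequential
    by (intro exI[of _ "\<lambda>n. p n + (0, s - r)"] conjI allI)
  then show ?thesis by simp
qed

lemma epigraph_convex_closure:
  "epigraph (convex_closure F) = closure (convex hull (epigraph F))"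
proof (intro set_eqI iffI)
  fix p assume p: "p \<in> closure (convex hull (epigraph F))"
  obtain x r where pr: "p = (x, r)" by (cases p)
  have "convex_closure F x \<le> ereal r"
    unfolding convex_closure_def by (rule INF_lower) (use p pr in simp)
  then show "p \<in> epigraph (convex_closure F)" by (simp add: epigraph_def pr)
next
  fix p assume p: "p \<in> epigraph (convex_closure F)"
  obtain x r where pr: "p = (x, r)" by (cases p)
  have le: "convex_closure F x \<le> ereal r" using p by (simp add: epigraph_def pr)
  have mem: "(x, r + 1 / real (Suc n)) \<in> closure (convex hull (epigraph F))" for n
  proof -
    have "convex_closure F x < ereal (r + 1 / real (Suc n))"
      using le by (rule order_le_less_trans) simp
    then obtain s where s: "(x, s) \<in> closure (convex hull (epigraph F))" "s < r + 1 / real (Suc n)"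
      unfolding convex_closure_def by (auto simp: INF_less_iff)
    show ?thesis
      by (rule closed_convex_hull_epigraph_upward[OF s(1) less_imp_le[OF s(2)]])
  qed
  have "(\<lambda>n. 1 / real (Suc n)) \<longlonglongrightarrow> 0" using LIMSEQ_inverse_real_of_nat
    by (simp add: inverse_eq_divide)
  then have "(\<lambda>n. (x, r + 1 / real (Suc n))) \<longlonglongrightarrow> (x, r + 0)"
    by (intro tendsto_intros)
  then show "p \<in> closure (convex hull (epigraph F))"
    using closed_sequentially[OF closed_closure mem] by (simp add: pr)
qed

subsection \<open>Payoff and values of the game\<close>

text \<open>Extended expectation; meaningful as soon as the positive part has finite integral.\<close>

definition ext_expectation :: "'a measure \<Rightarrow> ('a \<Rightarrow> ereal) \<Rightarrow> ereal" where
  "ext_expectation M X =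
     enn2ereal (\<integral>\<^sup>+x. e2ennreal (X x) \<partial>M) - enn2ereal (\<integral>\<^sup>+x. e2ennreal (- X x) \<partial>M)"

lemma ext_expectation_ereal:
  assumes "integrable M X"
  shows "ext_expectation M (\<lambda>x. ereal (X x)) = ereal (\<integral>x. X x \<partial>M)"
proof -
  have pos: "(\<integral>\<^sup>+x. ennreal (X x) \<partial>M) < \<infinity>"
    using assms by (simp add: real_integrable_def top.not_eq_extremum)
  have neg: "(\<integral>\<^sup>+x. ennreal (- X x) \<partial>M) < \<infinity>"
    using assms by (simp add: real_integrable_def top.not_eq_extremum)
  have eq: "e2ennreal (ereal r) = ennreal r" "e2ennreal (- ereal r) = ennreal (- r)" for r
    by (simp_all add: ennreal.abs_eq e2ennreal_def)
  obtain a where a: "(\<integral>\<^sup>+x. ennreal (X x) \<partial>M) = ennreal a" "a \<ge> 0"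
    using pos by (cases "\<integral>\<^sup>+x. ennreal (X x) \<partial>M" rule: ennreal_cases) auto
  obtain b where b: "(\<integral>\<^sup>+x. ennreal (- X x) \<partial>M) = ennreal b" "b \<ge> 0"
    using neg by (cases "\<integral>\<^sup>+x. ennreal (- X x) \<partial>M" rule: ennreal_cases) auto
  show ?thesis
    using a b by (simp add: ext_expectation_def eq real_lebesgue_integral_def[OF assms])
qed

definition gan_payoff :: "'x measure \<Rightarrow> 'z measure \<Rightarrow> (real \<Rightarrow> ereal) \<Rightarrow>
    (real ^ 't::finite \<Rightarrow> 'x \<Rightarrow> real) \<Rightarrow> (real ^ 'g::finite \<Rightarrow> 'z \<Rightarrow> 'x) \<Rightarrow>
    real ^ 'g \<Rightarrow> real ^ 't \<Rightarrow> ereal" where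
  "gan_payoff Pd Pz f D G \<gamma> \<theta> =
     ext_expectation Pd (\<lambda>x. f (D \<theta> x)) + ext_expectation Pz (\<lambda>z. f (1 - D \<theta> (G \<gamma> z)))"

text \<open>A tuple \<open>\<gamma>\<^sub>1, \<dots>, \<gamma>\<^sub>n\<close> is a function on \<^typ>\<open>nat\<close> of which only the values on
  \<open>{1..n}\<close> are used.\<close>

definition Phi :: "nat \<Rightarrow> (real ^ 'g::finite \<Rightarrow> real ^ 't::finite \<Rightarrow> ereal) \<Rightarrow>
    (nat \<Rightarrow> real ^ 'g) \<Rightarrow> real ^ 't \<Rightarrow> ereal" where
  "Phi n \<phi> \<gamma> \<theta> = (\<Sum>i=1..n. \<phi> (\<gamma> i) \<theta>)"

definition Phi_tilde :: "nat \<Rightarrow> (real ^ 'g::finite \<Rightarrow> real ^ 't::finite \<Rightarrow> ereal) \<Rightarrow>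
    (nat \<Rightarrow> real ^ 'g) \<Rightarrow> real ^ 't \<Rightarrow> ereal" where
  "Phi_tilde n \<phi> \<gamma> \<theta> = (\<Sum>i=1..n. concave_closure (\<phi> (\<gamma> i)) \<theta>)"

definition minimax :: "nat \<Rightarrow> ((nat \<Rightarrow> real ^ 'g::finite) \<Rightarrow> real ^ 't::finite \<Rightarrow> ereal) \<Rightarrow> ereal" where
  "minimax n \<Psi> = (INF \<gamma>. SUP \<theta>. ereal (1 / real n) * \<Psi> \<gamma> \<theta>)"

definition maximin :: "nat \<Rightarrow> ((nat \<Rightarrow> real ^ 'g::finite) \<Rightarrow> real ^ 't::finite \<Rightarrow> ereal) \<Rightarrow> ereal" where
  "maximin n \<Psi> = (SUP \<theta>. INF \<gamma>. ereal (1 / real n) * \<Psi> \<gamma> \<theta>)"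

definition w_star :: "nat \<Rightarrow> (real ^ 'g::finite \<Rightarrow> real ^ 't::finite \<Rightarrow> ereal) \<Rightarrow> ereal" where
  "w_star n \<phi> = minimax n (Phi n \<phi>)"

definition q_star :: "nat \<Rightarrow> (real ^ 'g::finite \<Rightarrow> real ^ 't::finite \<Rightarrow> ereal) \<Rightarrow> ereal" where
  "q_star n \<phi> = maximin n (Phi n \<phi>)"

definition Delta_theta_minimax :: "nat \<Rightarrow> (real ^ 'g::finite \<Rightarrow> real ^ 't::finite \<Rightarrow> ereal) \<Rightarrow> ereal" where
  "Delta_theta_minimax n \<phi> = minimax n (Phi n \<phi>) - minimax n (Phi_tilde n \<phi>)"

definition Delta_theta_maximin :: "nat \<Rightarrow> (real ^ 'g::finite \<Rightarrow> real ^ 't::finite \<Rightarrow> ereal) \<Rightarrow> ereal" where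
  "Delta_theta_maximin n \<phi> = maximin n (Phi_tilde n \<phi>) - maximin n (Phi n \<phi>)"

subsection \<open>Generator non-convexity\<close>

text \<open>All generators share the payoff \<open>\<phi>\<close>, so the index \<open>i\<close> below is nominal: the functions
  \<open>h\<^sub>i\<close> coincide. It is kept to match the usual notation.\<close>

definition h_fun :: "(real ^ 'g::finite \<Rightarrow> real ^ 't::finite \<Rightarrow> ereal) \<Rightarrow> nat \<Rightarrow> real ^ 't \<Rightarrow> ereal" where
  "h_fun \<phi> i u = (INF \<gamma>. conjugate (\<lambda>\<theta>. - \<phi> \<gamma> \<theta>) u)"

definition convex_closure_comb :: "(real ^ 't::finite \<Rightarrow> ereal) \<Rightarrow> real ^ 't \<Rightarrow> ereal" where
  "convex_closure_comb h v = Inf {(\<Sum>j=1..CARD('t) + 2. ereal (a j) * h (u j)) | (a :: nat \<Rightarrow> real) u.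
       v = (\<Sum>j=1..CARD('t) + 2. a j *\<^sub>R u j) \<and> (\<Sum>j=1..CARD('t) + 2. a j) = 1 \<and>
       (\<forall>j\<in>{1..CARD('t) + 2}. a j \<ge> 0)}"

text \<open>If \<open>h\<^sub>i\<close> takes the value \<open>-\<infinity>\<close> somewhere, then so does its convex closure, and the
  supremum is \<open>\<infinity>\<close> by the convention for \<open>-\<infinity> - -\<infinity>\<close>.\<close>

definition Delta_gamma :: "(real ^ 'g::finite \<Rightarrow> real ^ 't::finite \<Rightarrow> ereal) \<Rightarrow> nat \<Rightarrow> ereal" where
  "Delta_gamma \<phi> i = (SUP u. if u \<in> edom (h_fun \<phi> i)
      then h_fun \<phi> i u - convex_closure_comb (h_fun \<phi> i) u else 0)"

definition Delta_gamma_worst :: "nat \<Rightarrow> (real ^ 'g::finite \<Rightarrow> real ^ 't::finite \<Rightarrow> ereal) \<Rightarrow> ereal" where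
  "Delta_gamma_worst n \<phi> = (MAX i\<in>{1..n}. Delta_gamma \<phi> i)"

lemma convex_closure_comb_le: "convex_closure_comb h v \<le> h v"
proof -
  let ?a = "\<lambda>j::nat. if j = 1 then 1 else 0 :: real"
  have "(\<Sum>j=1..CARD('a) + 2. ereal (?a j) * h v) = (\<Sum>j=1..CARD('a) + 2. if j = 1 then h v else 0)"
    by (intro sum.cong) auto
  then have 1: "(\<Sum>j=1..CARD('a) + 2. ereal (?a j) * h v) = h v" by simp
  have "(\<Sum>j=1..CARD('a) + 2. ?a j *\<^sub>R v) = (\<Sum>j=1..CARD('a) + 2. if j = 1 then v else 0)"
    by (intro sum.cong) auto
  then have 2: "v = (\<Sum>j=1..CARD('a) + 2. ?a j *\<^sub>R v)" by simp
  have 3: "(\<Sum>j=1..CARD('a) + 2. ?a j) = 1" by simp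
  show ?thesis
    unfolding convex_closure_comb_def
    by (rule Inf_lower, rule CollectI, rule exI[of _ ?a], rule exI[of _ "\<lambda>_. v"])
      (use 1 2 3 in simp)
qed

lemma Delta_gamma_nonneg: "0 \<le> Delta_gamma \<phi> i"
  unfolding Delta_gamma_def
  by (rule SUP_upper2[of 0]) (simp_all add: convex_closure_comb_le ereal_diff_positive)

end

theory Submission
  imports Defs
begin

text \<open>
  The weak-duality inequalities \<open>q\<^sup>* \<le> w\<^sup>*\<close> and \<open>\<phi> \<le> concave_closure \<phi>\<close> reduce the claim to
  the bound \<open>minimax \<le> maximin + \<epsilon>\<close> for \<open>Phi_tilde\<close>. By Fenchel-Young, the minimax value is at
  most the mean of \<open>h (u i)\<close> for any \<open>u 1, \<dots>, u I\<close> with sum \<open>0\<close>. Conversely, if \<open>c\<close> exceeds the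
  maximin value then no affine function with value \<open>c\<close> at \<open>0\<close> lies below \<open>h\<close>, so
  separation and Caratheodory yield a convex combination of \<open>t + 2\<close> points of the domain
  that represents \<open>0\<close> and has \<open>h\<close>-average at most \<open>c\<close>. Separation from the graph
  is never vertical because \<open>0\<close> lies in the domain: \<open>\<phi>\<close> is bounded above. Since all \<open>h\<^sub>i\<close>
  coincide, rounding the weights to multiples of \<open>1 / I\<close> replaces the Shapley-Folkman lemma
  and costs at most \<open>(t + 1) * Delta_gamma / I < \<epsilon>\<close>.
\<close>

section \<open>Upper bounds for the payoff\<close>

lemma ext_expectation_le:
  assumes "prob_space M" "\<And>x. x \<in> space M \<Longrightarrow> X x \<le> ereal B" "0 \<le> B"
  shows "ext_expectation M X \<le> ereal B"
proof -
  interpret prob_space M by fact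
  have "(\<integral>\<^sup>+x. e2ennreal (X x) \<partial>M) \<le> (\<integral>\<^sup>+x. ennreal B \<partial>M)"
    using e2ennreal_mono[OF assms(2)] by (intro nn_integral_mono) simp
  then have "enn2ereal (\<integral>\<^sup>+x. e2ennreal (X x) \<partial>M) \<le> ereal B"
    using assms(3) by (simp add: emeasure_space_1 less_eq_ennreal.rep_eq enn2ereal_ennreal)
  moreover have "p - enn2ereal q \<le> p" for p q
    using enn2ereal_nonneg[of q] by (cases p; cases "enn2ereal q") auto
  ultimately show ?thesis
    unfolding ext_expectation_def by (rule order_trans[rotated])
qed

text \<open>Monotonicity puts the maximum of \<open>f\<close> on the unit interval at 1, where
  \<open>concave_on_ereal\<close> excludes the value \<infinity>. The bound serves twice: it places
  0 in the domain of \<open>h\<close>, and it lets vertical separating hyperplanes be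
  tilted.\<close>

lemma gan_payoff_bounded_above:
  assumes "prob_space Pd" "prob_space Pz"
    and "\<And>\<theta> x. x \<in> space Pd \<Longrightarrow> D \<theta> x \<in> {0..1}"
    and "\<And>\<gamma>. G \<gamma> \<in> measurable Pz Pd"
    and "concave_on_ereal {0..1} f" "mono_on {0..1} f"
  obtains C where "\<And>\<gamma> \<theta>. gan_payoff Pd Pz f D G \<gamma> \<theta> \<le> ereal C"
proof -
  \<comment> \<open>The truncation at 0 is for \<open>ext_expectation_le\<close>, which bounds the
    integral of the positive part and so asks for a nonnegative \<open>B\<close>.\<close>
  define B where "B = max 0 (real_of_ereal (f 1))"
  have "f 1 < \<infinity>" using assms(5) by (auto simp: concave_on_ereal_def)
  then have "f 1 \<le> ereal B" by (cases "f 1") (auto simp: B_def)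
  then have fB: "f p \<le> ereal B" if "p \<in> {0..1}" for p
    using mono_onD[OF assms(6), of p 1] that by (auto intro: order_trans)
  have "ext_expectation Pd (\<lambda>x. f (D \<theta> x)) \<le> ereal B" for \<theta>
    by (rule ext_expectation_le[OF assms(1)]) (use assms(3) fB B_def in auto)
  moreover have "ext_expectation Pz (\<lambda>z. f (1 - D \<theta> (G \<gamma> z))) \<le> ereal B" for \<theta> \<gamma>
  proof (rule ext_expectation_le[OF assms(2)])
    fix z assume "z \<in> space Pz"
    then have "D \<theta> (G \<gamma> z) \<in> {0..1}" using assms(3,4) by (blast dest: measurable_space)
    then show "f (1 - D \<theta> (G \<gamma> z)) \<le> ereal B" by (intro fB) auto
  qed (simp add: B_def)
  ultimately have "gan_payoff Pd Pz f D G \<gamma> \<theta> \<le> ereal B + ereal B" for \<gamma> \<theta>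
    unfolding gan_payoff_def by (intro add_mono)
  then show thesis using that[of "B + B"] by simp
qed

section \<open>Convex closures and conjugates\<close>

lemma convex_closure_le: "convex_closure F x \<le> F x"
proof (rule ereal_le_real)
  fix r assume "F x \<le> ereal r"
  then have "(x, r) \<in> closure (convex hull (epigraph F))"
    by (intro closure_subset[THEN subsetD] hull_inc) (simp add: epigraph_def)
  then show "convex_closure F x \<le> ereal r"
    using epigraph_convex_closure[of F] by (auto simp: epigraph_def)
qed

text \<open>A bound on the conjugate at \<open>u\<close> says that the epigraph lies in the closed
  half-space above an affine function of slope \<open>u\<close>. Being closed and convex, this
  half-space contains the closed convex hull as well.\<close>

lemma convex_closure_ge_of_conjugate_le:
  assumes "conjugate F u \<le> ereal k"
  shows "ereal (u \<bullet> x - k) \<le> convex_closure F x"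
proof -
  define H where "H = {p :: 'a \<times> real. (u, -1) \<bullet> p \<le> k}"
  have "epigraph F \<subseteq> H"
  proof
    fix p assume "p \<in> epigraph F"
    then obtain y r where p: "p = (y, r)" "F y \<le> ereal r" by (auto simp: epigraph_def)
    have "ereal (u \<bullet> y) - F y \<le> ereal k"
      using assms unfolding conjugate_def by (metis SUP_le_iff UNIV_I inner_commute)
    with p have "u \<bullet> y - r \<le> k" by (cases "F y") auto
    then show "p \<in> H" by (simp add: H_def p)
  qed
  moreover have "convex H" "closed H"
    unfolding H_def by (rule convex_halfspace_le, rule closed_halfspace_le)
  ultimately have "closure (convex hull (epigraph F)) \<subseteq> H"
    by (intro closure_minimal hull_minimal)
  then show ?thesis
    unfolding convex_closure_def by (intro INF_greatest) (auto simp: H_def)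
qed

text \<open>The harder half of biconjugation (Fenchel-Moreau). If \<open>(x, - c)\<close> were
  outside the closed convex hull of the epigraph, a strictly separating hyperplane would, once made
  non-vertical, have a slope \<open>u\<close> at which the conjugate is too small.\<close>

lemma convex_closure_le_of_conjugate_ge:
  assumes bound: "\<And>x. ereal (- C) \<le> F x"
    and conj: "\<And>u. ereal (c + u \<bullet> x) \<le> conjugate F u"
  shows "convex_closure F x \<le> ereal (- c)"
proof (rule ccontr)
  assume neg: "\<not> ?thesis"
  define E where "E = closure (convex hull (epigraph F))"
  have notin: "(x, - c) \<notin> E"
    using neg epigraph_convex_closure[of F] by (auto simp: epigraph_def E_def)
  have sub: "epigraph F \<subseteq> E"
    unfolding E_def by (meson closure_subset hull_subset order_trans)
  have "convex E" "closed E" unfolding E_def by (auto intro: convex_closure)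
  then obtain p \<beta> where "p \<bullet> (x, - c) < \<beta>" and "\<And>q. q \<in> E \<Longrightarrow> p \<bullet> q > \<beta>"
    using separating_hyperplane_closed_point[OF _ _ notin] by blast
  moreover obtain a b where p: "p = (a, b)" by (cases p)
  ultimately have ab: "a \<bullet> x - b * c < \<beta>"
    and abE: "\<And>y r. F y \<le> ereal r \<Longrightarrow> a \<bullet> y + b * r > \<beta>"
    using sub by (fastforce simp: epigraph_def)+
  have "\<exists>y. F y \<noteq> \<infinity>"
  proof (rule ccontr)
    assume "\<nexists>y. F y \<noteq> \<infinity>"
    then have "conjugate F 0 = -\<infinity>" by (simp add: conjugate_def)
    with conj[of 0] show False by simp
  qed
  then obtain y s where ys: "F y = ereal s"
    by (metis MInfty_neq_ereal(1) bound ereal_infty_less_eq(2) ereal_cases)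
  have "b \<ge> 0"
  proof (rule ccontr)
    assume "\<not> b \<ge> 0"
    \<comment> \<open>Over \<open>y\<close> the epigraph is unbounded upward; with \<open>b\<close>
      negative, this height pushes the functional down to \<open>\<beta>\<close> or below.\<close>
    define r where "r = max s ((\<beta> - a \<bullet> y) / b)"
    have "b * r \<le> b * ((\<beta> - a \<bullet> y) / b)"
      using \<open>\<not> b \<ge> 0\<close> by (intro mult_left_mono_neg) (auto simp: r_def)
    with abE[of y r] ys \<open>\<not> b \<ge> 0\<close> show False by (simp add: r_def)
  qed
  \<comment> \<open>The hyperplane may be vertical; the lower bound on \<open>F\<close> allows to tilt it by \<open>\<eta>\<close>.\<close>
  define M where "M = \<bar>C - c\<bar> + 1"
  have "C - c \<le> M" "M > 0"
    unfolding M_def using abs_ge_self[of "C - c"] by (auto intro: add_nonneg_pos)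
  \<comment> \<open>Half of the strict gap divided by \<open>M\<close>: the tilt then costs at most
    half of the gap, and the separation persists.\<close>
  define \<eta> where "\<eta> = (\<beta> - (a \<bullet> x - b * c)) / (2 * M)"
  have "\<eta> > 0" unfolding \<eta>_def using ab \<open>M > 0\<close> by (intro divide_pos_pos) auto
  then have "\<eta> * (C - c) \<le> \<eta> * M" using \<open>C - c \<le> M\<close> by (intro mult_left_mono) auto
  also have "\<dots> = (\<beta> - (a \<bullet> x - b * c)) / 2" using \<open>M > 0\<close> by (simp add: \<eta>_def)
  also have "\<dots> < \<beta> - (a \<bullet> x - b * c)" using ab by simp
  finally have \<eta>: "a \<bullet> x - (b + \<eta>) * c < \<beta> - \<eta> * C" by (simp add: algebra_simps)
  define d where "d = b + \<eta>"
  have "d > 0" using \<open>b \<ge> 0\<close> \<open>\<eta> > 0\<close> by (simp add: d_def)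
  \<comment> \<open>The slope obtained by solving the equation of the tilted hyperplane for its real
    coordinate.\<close>
  define u where "u = - (1 / d) *\<^sub>R a"
  have "conjugate F u \<le> ereal (- (\<beta> - \<eta> * C) / d)"
    unfolding conjugate_def
  proof (rule SUP_least)
    fix z
    show "ereal (z \<bullet> u) - F z \<le> ereal (- (\<beta> - \<eta> * C) / d)"
    proof (cases "F z")
      case (real r)
      have "\<eta> * (- C) \<le> \<eta> * r"
        using bound[of z] real \<open>\<eta> > 0\<close> by (intro mult_left_mono) auto
      then have "\<beta> - \<eta> * C \<le> a \<bullet> z + d * r"
        using abE[of z r] real by (simp add: d_def algebra_simps)
      then have "(\<beta> - \<eta> * C) / d \<le> (a \<bullet> z + d * r) / d"
        using \<open>d > 0\<close> by (intro divide_right_mono) auto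
      also have "\<dots> = a \<bullet> z / d + r" using \<open>d > 0\<close> by (simp add: field_simps)
      finally show ?thesis using real \<open>d > 0\<close>
        by (simp add: u_def inner_commute field_simps)
    qed (use bound[of z] in auto)
  qed
  with conj[of u] have "ereal (c + u \<bullet> x) \<le> ereal (- (\<beta> - \<eta> * C) / d)" by (rule order_trans)
  then have "(c - a \<bullet> x / d) * d \<le> - (\<beta> - \<eta> * C) / d * d"
    using \<open>d > 0\<close> by (intro mult_right_mono) (simp_all add: u_def)
  moreover have "(c - a \<bullet> x / d) * d = d * c - a \<bullet> x"
    using \<open>d > 0\<close> by (simp add: left_diff_distrib)
  moreover have "- (\<beta> - \<eta> * C) / d * d = - (\<beta> - \<eta> * C)"
    using \<open>d > 0\<close> by simp
  ultimately show False using \<eta>[folded d_def] by simp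
qed

section \<open>Values of the game and of its concave closure\<close>

lemma maximin_le_minimax: "maximin n \<Psi> \<le> minimax n \<Psi>"
  unfolding maximin_def minimax_def
  by (intro SUP_least INF_greatest) (meson INF_lower SUP_upper UNIV_I order_trans)

lemma minimax_mono: "(\<And>\<gamma> \<theta>. \<Psi> \<gamma> \<theta> \<le> \<Psi>' \<gamma> \<theta>) \<Longrightarrow> minimax n \<Psi> \<le> minimax n \<Psi>'"
  unfolding minimax_def by (intro INF_mono' SUP_mono' ereal_mult_left_mono) auto

lemma maximin_mono: "(\<And>\<gamma> \<theta>. \<Psi> \<gamma> \<theta> \<le> \<Psi>' \<gamma> \<theta>) \<Longrightarrow> maximin n \<Psi> \<le> maximin n \<Psi>'"
  unfolding maximin_def by (intro INF_mono' SUP_mono' ereal_mult_left_mono) auto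

lemma Phi_le_Phi_tilde: "Phi n \<phi> \<gamma> \<theta> \<le> Phi_tilde n \<phi> \<gamma> \<theta>"
  unfolding Phi_def Phi_tilde_def
proof (rule sum_mono)
  fix i
  show "\<phi> (\<gamma> i) \<theta> \<le> concave_closure (\<phi> (\<gamma> i)) \<theta>"
    using convex_closure_le[of "\<lambda>\<theta>. - \<phi> (\<gamma> i) \<theta>" \<theta>] unfolding concave_closure_def
    by (metis ereal_minus_le_minus ereal_uminus_uminus)
qed

text \<open>The strict bound yields a \<open>\<gamma> i\<close> nearly attaining the infimum that
  defines \<open>h_fun\<close> at \<open>u i\<close>. Fenchel-Young then bounds the concave closures
  by affine functions of \<open>\<theta>\<close>, whose slopes cancel because the \<open>u i\<close>
  sum to 0.\<close>

lemma minimax_Phi_tilde_le: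
  fixes u :: "nat \<Rightarrow> real ^ 't::finite" and \<phi> :: "real ^ 'g::finite \<Rightarrow> real ^ 't \<Rightarrow> ereal"
  assumes "n > 0" and sum0: "(\<Sum>i=1..n. u i) = 0"
    and h: "\<And>i. i \<in> {1..n} \<Longrightarrow> h_fun \<phi> i (u i) < ereal (k i)"
  shows "minimax n (Phi_tilde n \<phi>) \<le> ereal ((\<Sum>i=1..n. k i) / real n)"
proof -
  have "\<exists>\<gamma>. conjugate (\<lambda>\<theta>. - \<phi> \<gamma> \<theta>) (u i) \<le> ereal (k i)" if "i \<in> {1..n}" for i
    using h[OF that] unfolding h_fun_def INF_less_iff by (auto intro: less_imp_le)
  then obtain \<gamma> where \<gamma>: "\<And>i. i \<in> {1..n} \<Longrightarrow>
      conjugate (\<lambda>\<theta>. - \<phi> (\<gamma> i) \<theta>) (u i) \<le> ereal (k i)" by metis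
  have "ereal (1 / real n) * Phi_tilde n \<phi> \<gamma> \<theta> \<le> ereal ((\<Sum>i=1..n. k i) / real n)" for \<theta>
  proof -
    have "Phi_tilde n \<phi> \<gamma> \<theta> \<le> (\<Sum>i=1..n. ereal (k i - u i \<bullet> \<theta>))"
      unfolding Phi_tilde_def
    proof (rule sum_mono)
      fix i assume "i \<in> {1..n}"
      from convex_closure_ge_of_conjugate_le[OF \<gamma>[OF this], of \<theta>]
      show "concave_closure (\<phi> (\<gamma> i)) \<theta> \<le> ereal (k i - u i \<bullet> \<theta>)"
        unfolding concave_closure_def
          by (metis ereal_minus_le_minus ereal_uminus_uminus minus_diff_eq uminus_ereal.simps(1))
    qed
    also have "\<dots> = ereal ((\<Sum>i=1..n. k i) - (\<Sum>i=1..n. u i) \<bullet> \<theta>)"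
      by (simp add: sum_subtractf inner_sum_left)
    finally have "Phi_tilde n \<phi> \<gamma> \<theta> \<le> ereal (\<Sum>i=1..n. k i)" unfolding sum0 by simp
    then have "ereal (1 / real n) * Phi_tilde n \<phi> \<gamma> \<theta> \<le> ereal (1 / real n) * ereal (\<Sum>i=1..n. k i)"
      by (intro ereal_mult_left_mono) auto
    then show ?thesis by simp
  qed
  then show ?thesis unfolding minimax_def by (blast intro: INF_lower2 SUP_least)
qed

text \<open>The slope of an affine minorant of \<open>h_fun\<close> serves as the discriminator
  parameter. The minorant lies below the conjugate for every \<open>\<gamma>\<close>, so
  biconjugation bounds all concave closures from below at this one \<open>\<theta>\<close>.\<close>

lemma maximin_Phi_tilde_ge:
  fixes \<phi> :: "real ^ 'g::finite \<Rightarrow> real ^ 't::finite \<Rightarrow> ereal"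
  assumes "n > 0" and bound: "\<And>\<gamma> \<theta>. \<phi> \<gamma> \<theta> \<le> ereal C"
    and h: "\<And>u. ereal (c + u \<bullet> \<theta>) \<le> h_fun \<phi> i u"
  shows "ereal c \<le> maximin n (Phi_tilde n \<phi>)"
proof -
  have c: "ereal c \<le> concave_closure (\<phi> \<gamma>) \<theta>" for \<gamma>
  proof -
    have "ereal (- C) \<le> - \<phi> \<gamma> \<theta>" for \<theta>
      using bound[of \<gamma> \<theta>] by (cases "\<phi> \<gamma> \<theta>") auto
    moreover have "ereal (c + u \<bullet> \<theta>) \<le> conjugate (\<lambda>\<theta>. - \<phi> \<gamma> \<theta>) u" for u
      using h[of u] unfolding h_fun_def by (auto simp: le_INF_iff)
    ultimately have "convex_closure (\<lambda>\<theta>. - \<phi> \<gamma> \<theta>) \<theta> \<le> ereal (- c)"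
      by (rule convex_closure_le_of_conjugate_ge)
    then show ?thesis unfolding concave_closure_def
      by (metis ereal_minus_le_minus ereal_uminus_uminus uminus_ereal.simps(1))
  qed
  have "ereal c \<le> ereal (1 / real n) * Phi_tilde n \<phi> \<gamma> \<theta>" for \<gamma>
  proof -
    have "(\<Sum>i=1..n. ereal c) \<le> Phi_tilde n \<phi> \<gamma> \<theta>"
      unfolding Phi_tilde_def by (intro sum_mono c)
    then have "ereal (1 / real n) * (\<Sum>i=1..n. ereal c) \<le> ereal (1 / real n) * Phi_tilde n \<phi> \<gamma> \<theta>"
      by (intro ereal_mult_left_mono) auto
    then show ?thesis using \<open>n > 0\<close> by simp
  qed
  then show ?thesis unfolding maximin_def by (blast intro: SUP_upper2 INF_greatest)
qed

section \<open>Caratheodory's theorem and separation from a graph\<close>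

text \<open>Caratheodory's theorem in the shape used by \<open>convex_closure_comb\<close>: a fixed
  index range, padded by an arbitrary point \<open>x0\<close> of the set with weight 0.\<close>

lemma convex_hull_indexed:
  fixes p :: "'a::euclidean_space set"
  assumes "y \<in> convex hull p"
  obtains a x where "\<And>j. x j \<in> p" "\<And>j. (0::real) \<le> a j"
    "(\<Sum>j=1..DIM('a) + 1. a j) = 1" "(\<Sum>j=1..DIM('a) + 1. a j *\<^sub>R x j) = y"
proof -
  obtain S w where S: "finite S" "S \<subseteq> p" "card S \<le> DIM('a) + 1"
    and w: "\<And>x. x \<in> S \<Longrightarrow> 0 \<le> w x" "sum w S = 1" "(\<Sum>v\<in>S. w v *\<^sub>R v) = y"
    using assms unfolding convex_hull_caratheodory by auto
  obtain e where e: "bij_betw e {1..card S} S" using ex_bij_betw_nat_finite_1[OF S(1)] by blast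
  have "S \<noteq> {}" using w(2) by auto
  then obtain x0 where "x0 \<in> p" using S(2) by blast
  define a where "a j = (if j \<in> {1..card S} then w (e j) else 0)" for j
  define x where "x j = (if j \<in> {1..card S} then e j else x0)" for j
  have eS: "e j \<in> S" if "j \<in> {1..card S}" for j using e that by (auto simp: bij_betw_def)
  have "(\<Sum>j=1..DIM('a) + 1. a j) = (\<Sum>j=1..card S. w (e j))"
    using S(3) by (intro sum.mono_neutral_cong_right) (auto simp: a_def)
  also have "\<dots> = 1" using sum.reindex_bij_betw[OF e, of w] w(2) by simp
  finally have 1: "(\<Sum>j=1..DIM('a) + 1. a j) = 1" .
  have "(\<Sum>j=1..DIM('a) + 1. a j *\<^sub>R x j) = (\<Sum>j=1..card S. w (e j) *\<^sub>R e j)"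
    using S(3) by (intro sum.mono_neutral_cong_right) (auto simp: a_def x_def)
  also have "\<dots> = y" using sum.reindex_bij_betw[OF e, of "\<lambda>v. w v *\<^sub>R v"] w(3) by simp
  finally have 2: "(\<Sum>j=1..DIM('a) + 1. a j *\<^sub>R x j) = y" .
  show thesis
  proof (rule that[of x a, OF _ _ 1 2])
    show "x j \<in> p" for j using eS[of j] S(2) \<open>x0 \<in> p\<close> by (auto simp: x_def)
    show "0 \<le> a j" for j using eS[of j] w(1) by (auto simp: a_def)
  qed
qed

text \<open>The alternative is whether the convex hull of the graph meets the vertical ray going
  down from \<open>(0, c)\<close>. If they are disjoint, compactness of the hull permits strict
  separation; a common point yields the weights by Caratheodory.\<close>

lemma affine_minorant_or_combination:
  fixes h :: "'a::euclidean_space \<Rightarrow> real"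
  assumes S: "compact S" "0 \<in> S" and h: "continuous_on S h"
  obtains (minorant) \<theta> where "\<And>u. u \<in> S \<Longrightarrow> c + u \<bullet> \<theta> \<le> h u"
  | (combination) a u where "\<And>j. u j \<in> S" "\<And>j. (0::real) \<le> a j"
    "(\<Sum>j=1..DIM('a) + 2. a j) = 1" "(\<Sum>j=1..DIM('a) + 2. a j *\<^sub>R u j) = 0"
    "(\<Sum>j=1..DIM('a) + 2. a j * h (u j)) \<le> c"
proof -
  define \<Gamma> where "\<Gamma> = (\<lambda>u. (u, h u)) ` S"
  have "compact \<Gamma>"
    unfolding \<Gamma>_def by (intro compact_continuous_image continuous_on_Pair continuous_on_id h S)
  define K where "K = convex hull \<Gamma>"
  have K: "compact K" "convex K"
    unfolding K_def using \<open>compact \<Gamma>\<close> by (auto intro: compact_convex_hull)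
  define U :: "('a \<times> real) set" where "U = {0} \<times> {..c}"
  have U: "closed U" "convex U" unfolding U_def by (auto intro: closed_Times convex_Times)
  have "\<Gamma> \<noteq> {}" using S(2) by (auto simp: \<Gamma>_def)
  show thesis
  proof (cases "K \<inter> U = {}")
    case True
    have "K \<noteq> {}" using \<open>\<Gamma> \<noteq> {}\<close> by (simp add: K_def)
    then obtain p \<beta> where sepU: "\<And>q. q \<in> U \<Longrightarrow> p \<bullet> q < \<beta>" and sepK: "\<And>q. q \<in> K \<Longrightarrow> p \<bullet> q > \<beta>"
      using separating_hyperplane_closed_compact[OF U(2,1) K(2,1)] True by blast
    obtain a b where p: "p = (a, b)" by (cases p)
    have bc: "b * r < \<beta>" if "r \<le> c" for r
      using sepU[of "(0, r)"] that by (simp add: U_def p)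
    have graph: "a \<bullet> u + b * h u > \<beta>" if "u \<in> S" for u
      using sepK[of "(u, h u)"] that by (simp add: K_def hull_inc \<Gamma>_def p)
    \<comment> \<open>The graph has a point over 0, and some point of the ray lies at or below it,
      so \<open>b \<le> 0\<close> would contradict the separation.\<close>
    have "b > 0"
      using bc[of "min c (h 0)"] graph[OF S(2)]
      by (smt (verit) inner_zero_right mult_left_mono_neg)
    have "c + u \<bullet> (- (1 / b) *\<^sub>R a) \<le> h u" if "u \<in> S" for u
    proof -
      have "b * c < a \<bullet> u + b * h u" using bc[of c] graph[OF that] by simp
      then show ?thesis using \<open>b > 0\<close> by (simp add: inner_commute field_simps)
    qed
    then show thesis by (rule minorant)
  next
    case False
    then obtain r where r: "r \<le> c" "(0, r) \<in> K" by (auto simp: U_def)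
    obtain a x where x: "\<And>j. x j \<in> \<Gamma>" and a: "\<And>j. (0::real) \<le> a j"
      "(\<Sum>j=1..DIM('a \<times> real) + 1. a j) = 1" "(\<Sum>j=1..DIM('a \<times> real) + 1. a j *\<^sub>R x j) = (0, r)"
      using convex_hull_indexed[OF r(2)[unfolded K_def]] by metis
    have x_eq: "x j = (fst (x j), h (fst (x j)))" and xS: "fst (x j) \<in> S" for j
      using x[of j] by (auto simp: \<Gamma>_def)
    \<comment> \<open>The extra coordinate of the graph raises the number of points from dimension
      plus one to dimension plus two.\<close>
    have dim: "DIM('a \<times> real) + 1 = DIM('a) + 2" by simp
    have "(\<Sum>j=1..DIM('a) + 2. a j *\<^sub>R fst (x j)) = 0"
      using arg_cong[OF a(3), of fst] unfolding dim by (simp add: fst_sum)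
    moreover have "(\<Sum>j=1..DIM('a) + 2. a j * h (fst (x j))) = r"
      using arg_cong[OF a(3), of snd] x_eq unfolding dim
      by (simp add: snd_sum) (metis (no_types, lifting) snd_conv sum.cong)
    ultimately show thesis
      using combination[of "\<lambda>j. fst (x j)" a] xS a(1,2) r(1) unfolding dim by auto
  qed
qed

section \<open>Rounding convex weights to equal weights\<close>

lemma sum_list_replicate_scaleR:
  "sum_list (replicate n (y :: 'b::real_vector)) = real n *\<^sub>R y"
  by (induction n) (auto simp: algebra_simps)

text \<open>With \<open>F\<close> arbitrary, one identity later gives the length of the list, the
  sum of its points and the sum of \<open>h\<close> over them.\<close>

lemma sum_list_replicate_blocks:
  fixes F :: "'a \<Rightarrow> 'b::real_vector"
  shows "sum_list (map F (concat (map (\<lambda>j. replicate (k j) (u j)) [1..<Suc m])))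
    = (\<Sum>j=1..m. real (k j) *\<^sub>R F (u j))"
proof (induction m)
  case (Suc m)
  have "[1..<Suc (Suc m)] = [1..<Suc m] @ [Suc m]" by simp
  then show ?case
    using Suc by (simp del: upt_Suc add: sum_list_replicate_scaleR map_replicate)
qed simp

text \<open>Each point \<open>u j\<close> is used \<open>\<lfloor>n * a j\<rfloor>\<close> times. The fractional parts sum to an integer
  below \<open>m + 1\<close>, and that many copies of their barycentre complete the list; only these
  at most \<open>m\<close> copies suffer from the non-convexity of \<open>h\<close>.\<close>

lemma equal_weight_combination:
  fixes h :: "'a::real_vector \<Rightarrow> real"
  assumes S: "convex S" "\<And>j. u j \<in> S"
    and a: "\<And>j. 0 \<le> a j" "(\<Sum>j=1..m + 1. a j) = 1"
    and h: "\<And>b. (\<And>j. 0 \<le> b j) \<Longrightarrow> (\<Sum>j=1..m + 1. b j) = 1 \<Longrightarrow>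
      h (\<Sum>j=1..m + 1. b j *\<^sub>R u j) \<le> (\<Sum>j=1..m + 1. b j * h (u j)) + \<Delta>"
    and "0 \<le> \<Delta>"
  obtains x :: "nat \<Rightarrow> 'a" where "\<And>i. i \<in> {1..n} \<Longrightarrow> x i \<in> S"
    "(\<Sum>i=1..n. x i) = real n *\<^sub>R (\<Sum>j=1..m + 1. a j *\<^sub>R u j)"
    "(\<Sum>i=1..n. h (x i)) \<le> real n * (\<Sum>j=1..m + 1. a j * h (u j)) + real m * \<Delta>"
proof -
  define k where "k j = nat \<lfloor>real n * a j\<rfloor>" for j
  define d where "d j = real n * a j - real (k j)" for j
  have k: "real (k j) = of_int \<lfloor>real n * a j\<rfloor>" for j using a(1) by (simp add: k_def)
  have d: "0 \<le> d j" "d j < 1" for j unfolding d_def k by linarith+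
  have split: "real n * a j = real (k j) + d j" for j by (simp add: d_def)
  have sum_d: "(\<Sum>j=1..m + 1. d j) = real n - real (\<Sum>j=1..m + 1. k j)"
    unfolding d_def sum_subtractf sum_distrib_left[symmetric] a(2) by simp
  have "0 \<le> (\<Sum>j=1..m + 1. d j)" using d by (intro sum_nonneg) auto
  then have k_le: "(\<Sum>j=1..m + 1. k j) \<le> n" using sum_d by linarith
  \<comment> \<open>By \<open>k_le\<close> this subtraction of natural numbers is not
    truncated.\<close>
  define r where "r = n - (\<Sum>j=1..m + 1. k j)"
  have r: "real r = (\<Sum>j=1..m + 1. d j)" using sum_d k_le by (simp add: r_def of_nat_diff)
  have "(\<Sum>j=1..m + 1. d j) < (\<Sum>j=1..m + 1. 1)" using d by (intro sum_strict_mono) auto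
  then have "r \<le> m" using r by simp
  define v where "v = (\<Sum>j=1..m + 1. (d j / real r) *\<^sub>R u j)"
  \<comment> \<open>If \<open>r = 0\<close>, division by zero makes \<open>v\<close> equal to 0,
    possibly outside \<open>S\<close>. All \<open>d j\<close> then vanish, so the identities scaled
    by \<open>r\<close> remain valid.\<close>
  have d0: "d j = 0" if "r = 0" "j \<in> {1..m + 1}" for j
    using r that d by (simp add: sum_nonneg_eq_0_iff del: sum.cl_ivl_Suc)
  have r_d: "real r * (d j / real r) = d j" if "j \<in> {1..m + 1}" for j
    using d0 that by (cases "r = 0") auto
  have weights: "(\<Sum>j=1..m + 1. d j / real r) = 1" if "r > 0"
    using that unfolding sum_divide_distrib[symmetric] r[symmetric] by simp
  have v_mem: "v \<in> S" if "r > 0"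
    unfolding v_def using weights[OF that] d S by (intro convex_sum) auto
  have v_sum: "real r *\<^sub>R v = (\<Sum>j=1..m + 1. d j *\<^sub>R u j)"
    unfolding v_def scaleR_sum_right scaleR_scaleR by (intro sum.cong refl) (simp only: r_d)
  have "(\<Sum>j=1..m + 1. d j * h (u j)) = real r * (\<Sum>j=1..m + 1. d j / real r * h (u j))"
    unfolding sum_distrib_left mult.assoc[symmetric] by (intro sum.cong refl) (simp only: r_d)
  moreover have "h v \<le> (\<Sum>j=1..m + 1. d j / real r * h (u j)) + \<Delta>" if "r > 0"
    unfolding v_def using weights[OF that] d by (intro h) auto
  then have "real r * h v \<le> real r * ((\<Sum>j=1..m + 1. d j / real r * h (u j)) + \<Delta>)"
    by (cases "r = 0") (auto intro: mult_left_mono)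
  moreover have "real r * \<Delta> \<le> real m * \<Delta>"
    using \<open>r \<le> m\<close> \<open>0 \<le> \<Delta>\<close> by (intro mult_right_mono) auto
  ultimately have v_h: "real r * h v \<le> (\<Sum>j=1..m + 1. d j * h (u j)) + real m * \<Delta>"
    unfolding distrib_left by linarith
  define xs where
    "xs = concat (map (\<lambda>j. replicate (k j) (u j)) [1..<Suc (m + 1)]) @ replicate r v"
  have list_sum: "sum_list (map F xs) = (\<Sum>j=1..m + 1. real (k j) *\<^sub>R F (u j)) + real r *\<^sub>R F v"
    for F :: "'a \<Rightarrow> 'b::real_vector"
    unfolding xs_def map_append sum_list_append sum_list_replicate_blocks map_replicate
      sum_list_replicate_scaleR ..
  have "real (length xs) = sum_list (map (\<lambda>_. 1 :: real) xs)" by (simp add: sum_list_triv)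
  also have "\<dots> = real n" unfolding list_sum using r sum_d by simp
  finally have len: "length xs = n" by simp
  \<comment> \<open>Lists are indexed from 0, tuples from 1.\<close>
  define x where "x i = xs ! (i - 1)" for i
  have x_sum: "(\<Sum>i=1..n. F (x i)) = sum_list (map F xs)" for F :: "'a \<Rightarrow> 'b::real_vector"
    unfolding sum_list_sum_nth length_map len x_def
    by (rule sum.reindex_bij_witness[of _ "\<lambda>i. i + 1" "\<lambda>i. i - 1"]) (auto simp: len)
  have "set xs \<subseteq> S" using S(2) v_mem by (auto simp: xs_def simp del: upt_Suc split: if_splits)
  then have "x i \<in> S" if "i \<in> {1..n}" for i
    using that len unfolding x_def by (intro subsetD[OF _ nth_mem]) auto
  moreover have "(\<Sum>i=1..n. x i) = real n *\<^sub>R (\<Sum>j=1..m + 1. a j *\<^sub>R u j)"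
    using x_sum[of "\<lambda>y. y"] list_sum[of "\<lambda>y. y"]
    unfolding v_sum scaleR_sum_right scaleR_scaleR split scaleR_add_left sum.distrib by simp
  moreover have "(\<Sum>i=1..n. h (x i)) \<le> real n * (\<Sum>j=1..m + 1. a j * h (u j)) + real m * \<Delta>"
    using v_h unfolding x_sum list_sum sum_distrib_left mult.assoc[symmetric] split
      distrib_right sum.distrib real_scaleR_def by linarith
  ultimately show thesis by (rule that)
qed

section \<open>Approximate duality and conclusion\<close>

lemma h_fun_index: "h_fun \<phi> i = h_fun \<phi> j"
  by (simp add: h_fun_def fun_eq_iff)

lemma convex_closure_comb_le_sum:
  fixes h :: "real ^ 't::finite \<Rightarrow> ereal"
  assumes "\<And>j. 0 \<le> a j" "(\<Sum>j=1..CARD('t) + 2. a j) = 1"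
  shows "convex_closure_comb h (\<Sum>j=1..CARD('t) + 2. a j *\<^sub>R u j)
    \<le> (\<Sum>j=1..CARD('t) + 2. ereal (a j) * h (u j))"
  unfolding convex_closure_comb_def
  by (rule Inf_lower, rule CollectI, rule exI[of _ a], rule exI[of _ u])
    (intro conjI refl ballI assms)

text \<open>Approximate strong duality for the concavified game, stated with index 1 since
  \<open>h_fun\<close> ignores its index. The second conclusion excludes the value \<infinity> from
  the final arithmetic.\<close>

lemma minimax_le_maximin_Phi_tilde:
  fixes \<phi> :: "real ^ 'g::finite \<Rightarrow> real ^ 't::finite \<Rightarrow> ereal"
  defines "h \<equiv> h_fun \<phi> 1"
  assumes bound: "\<And>\<gamma> \<theta>. \<phi> \<gamma> \<theta> \<le> ereal C" and "n > 0" "\<epsilon> > 0"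
    and S: "compact (edom h)" "convex (edom h)" and cont: "continuous_on (edom h) h"
    and n: "ereal ((real CARD('t) + 1) / \<epsilon>) * Delta_gamma \<phi> 1 < ereal (real n)"
  shows "minimax n (Phi_tilde n \<phi>) \<le> maximin n (Phi_tilde n \<phi>) + ereal \<epsilon>"
    and "minimax n (Phi_tilde n \<phi>) < \<infinity>"
proof -
  let ?m = "CARD('t) + 1"
  define S where "S = edom h"
  define \<Delta> where "\<Delta> = real_of_ereal (Delta_gamma \<phi> 1)"
  define K where "K = (real CARD('t) + 1) / \<epsilon>"
  have "K > 0" unfolding K_def using \<open>\<epsilon> > 0\<close> by (intro divide_pos_pos) auto
  \<comment> \<open>An infinite gap times the positive \<open>K\<close> would be \<infinity>,
    against the bound by \<open>n\<close>; hence the gap is real.\<close>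
  then have \<Delta>: "Delta_gamma \<phi> 1 = ereal \<Delta>"
    using n[folded K_def] Delta_gamma_nonneg[of \<phi> 1] unfolding \<Delta>_def
    by (cases "Delta_gamma \<phi> 1") auto
  then have "0 \<le> \<Delta>" using Delta_gamma_nonneg[of \<phi> 1] by simp
  have n\<Delta>: "real ?m * \<Delta> < real n * \<epsilon>"
    using n \<open>\<epsilon> > 0\<close> unfolding \<Delta> by (simp add: field_simps)
  have gap: "h u - convex_closure_comb h u \<le> ereal \<Delta>" if "u \<in> S" for u
    unfolding \<Delta>[symmetric] Delta_gamma_def h_def
    by (rule SUP_upper2[of u]) (use that in \<open>auto simp: S_def h_def\<close>)
  define hr where "hr u = real_of_ereal (h u)" for u
  have hr: "h u = ereal (hr u)" if "u \<in> S" for u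
  proof (cases "h u")
    case MInf
    \<comment> \<open>The value -\<infinity> passes to the convex closure, and the difference is
      then \<infinity> by convention, against the finite gap.\<close>
    then have "convex_closure_comb h u = - \<infinity>" using convex_closure_comb_le[of h u] by simp
    with MInf gap[OF that] show ?thesis by simp
  qed (use that in \<open>auto simp: hr_def S_def edom_def\<close>)
  have cont_hr: "continuous_on S hr"
  proof -
    have "\<bar>h u\<bar> \<noteq> \<infinity>" if "u \<in> S" for u using hr[OF that] by simp
    then show ?thesis
      using cont continuous_on_iff_real[of S h] by (simp add: hr_def[abs_def] S_def o_def)
  qed
  \<comment> \<open>At slope 0 the conjugate is the supremum of \<open>\<phi>\<close> over
    \<open>\<theta>\<close>, which \<open>C\<close> bounds; the generator parameter 0 is an
    arbitrary choice.\<close>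
  have "h 0 \<le> conjugate (\<lambda>\<theta>. - \<phi> 0 \<theta>) 0" unfolding h_def h_fun_def by (rule INF_lower) simp
  also have "\<dots> \<le> ereal C" unfolding conjugate_def using bound by (intro SUP_least) simp
  finally have "0 \<in> S" by (auto simp: S_def edom_def)
  have le: "minimax n (Phi_tilde n \<phi>) \<le> ereal ((\<Sum>i=1..n. hr (x i)) / real n)"
    if x: "\<And>i. i \<in> {1..n} \<Longrightarrow> x i \<in> S" "(\<Sum>i=1..n. x i) = 0" for x
  proof (rule ereal_le_epsilon2)
    \<comment> \<open>The slack \<open>e\<close> is there because the infimum in \<open>h\<close>
      may not be attained.\<close>
    fix e :: real assume "e > 0"
    have "minimax n (Phi_tilde n \<phi>) \<le> ereal ((\<Sum>i=1..n. hr (x i) + e) / real n)"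
      using \<open>n > 0\<close> x(2)
    proof (rule minimax_Phi_tilde_le)
      fix i assume "i \<in> {1..n}"
      then show "h_fun \<phi> i (x i) < ereal (hr (x i) + e)"
        using hr[OF x(1)] \<open>e > 0\<close> h_fun_index[of \<phi> i 1] by (simp add: h_def)
    qed
    then show "minimax n (Phi_tilde n \<phi>) \<le> ereal ((\<Sum>i=1..n. hr (x i)) / real n) + ereal e"
      using \<open>n > 0\<close> by (simp add: sum.distrib add_divide_distrib)
  qed
  from le[of "\<lambda>_. 0"] \<open>0 \<in> S\<close> show "minimax n (Phi_tilde n \<phi>) < \<infinity>"
    by (auto intro: order_le_less_trans)
  \<comment> \<open>A real \<open>c\<close> strictly above the maximin value stands in for it, so
    that infinite values need no separate argument; density of the reals recovers the bound
    afterwards.\<close>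
  have "minimax n (Phi_tilde n \<phi>) - ereal \<epsilon> \<le> ereal c"
    if c: "maximin n (Phi_tilde n \<phi>) < ereal c" for c
  proof (rule affine_minorant_or_combination[OF S(1)[folded S_def] \<open>0 \<in> S\<close> cont_hr, of c])
    fix \<theta> assume minorant: "\<And>u. u \<in> S \<Longrightarrow> c + u \<bullet> \<theta> \<le> hr u"
    \<comment> \<open>Outside \<open>S\<close> the value of \<open>h\<close> is \<infinity>, so the
      minorant extends to the whole space.\<close>
    have "ereal (c + u \<bullet> \<theta>) \<le> h_fun \<phi> 1 u" for u
    proof (cases "u \<in> S")
      case True
      then show ?thesis using minorant hr by (simp add: h_def)
    qed (simp add: S_def edom_def h_def)
    then have "ereal c \<le> maximin n (Phi_tilde n \<phi>)"
      by (rule maximin_Phi_tilde_ge[OF \<open>n > 0\<close> bound])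
    with c show ?thesis by simp
  next
    fix a u assume combination: "\<And>j. u j \<in> S" "\<And>j. (0::real) \<le> a j"
      "(\<Sum>j=1..DIM(real ^ 't) + 2. a j) = 1" "(\<Sum>j=1..DIM(real ^ 't) + 2. a j *\<^sub>R u j) = 0"
      "(\<Sum>j=1..DIM(real ^ 't) + 2. a j * hr (u j)) \<le> c"
    \<comment> \<open>The rounding lemma takes \<open>m + 1\<close> points, here
      \<open>CARD('t) + 2\<close>; so \<open>m\<close> is \<open>CARD('t) + 1\<close>, the factor in
      the hypothesis on \<open>n\<close>.\<close>
    have m: "DIM(real ^ 't) + 2 = ?m + 1" "CARD('t) + 2 = ?m + 1" by simp_all
    \<comment> \<open>Any reweighting of the same points competes in the infimum of
      \<open>convex_closure_comb\<close>, so the gap bounds how far \<open>h\<close> can exceed its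
      average.\<close>
    have "hr (\<Sum>j=1..?m + 1. b j *\<^sub>R u j) \<le> (\<Sum>j=1..?m + 1. b j * hr (u j)) + \<Delta>"
      if b: "\<And>j. 0 \<le> b j" "(\<Sum>j=1..?m + 1. b j) = 1" for b
    proof -
      define v where "v = (\<Sum>j=1..?m + 1. b j *\<^sub>R u j)"
      have "v \<in> S"
        unfolding v_def using b combination(1) S(2) by (intro convex_sum) (auto simp: S_def)
      have "convex_closure_comb h v \<le> (\<Sum>j=1..?m + 1. ereal (b j) * h (u j))"
        unfolding v_def using convex_closure_comb_le_sum[of b h u] b unfolding m by blast
      also have "\<dots> = ereal (\<Sum>j=1..?m + 1. b j * hr (u j))"
        using hr[OF combination(1)] by simp
      finally have "ereal (hr v) \<le> ereal (\<Sum>j=1..?m + 1. b j * hr (u j)) + ereal \<Delta>"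
        using gap[OF \<open>v \<in> S\<close>] hr[OF \<open>v \<in> S\<close>] by (cases "convex_closure_comb h v") auto
      then show ?thesis unfolding v_def by simp
    qed
    then obtain x where x: "\<And>i. i \<in> {1..n} \<Longrightarrow> x i \<in> S"
      "(\<Sum>i=1..n. x i) = real n *\<^sub>R (\<Sum>j=1..?m + 1. a j *\<^sub>R u j)"
      "(\<Sum>i=1..n. hr (x i)) \<le> real n * (\<Sum>j=1..?m + 1. a j * hr (u j)) + real ?m * \<Delta>"
      using equal_weight_combination[of S u a ?m hr \<Delta> n] S(2) combination(1,2)
        combination(3)[unfolded m] \<open>0 \<le> \<Delta>\<close> unfolding S_def by blast
    have "(\<Sum>i=1..n. x i) = 0" unfolding x(2) using combination(4) unfolding m by simp
    with x(1) have "minimax n (Phi_tilde n \<phi>) \<le> ereal ((\<Sum>i=1..n. hr (x i)) / real n)"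
      by (rule le)
    also have "(\<Sum>i=1..n. hr (x i)) \<le> real n * c + real n * \<epsilon>"
    proof -
      have "real n * (\<Sum>j=1..?m + 1. a j * hr (u j)) \<le> real n * c"
        using combination(5) unfolding m by (intro mult_left_mono) auto
      with x(3) n\<Delta> show ?thesis by linarith
    qed
    then have "(\<Sum>i=1..n. hr (x i)) / real n \<le> c + \<epsilon>"
      using \<open>n > 0\<close> by (simp add: field_simps)
    finally show ?thesis by (cases "minimax n (Phi_tilde n \<phi>)") auto
  qed
  then have "minimax n (Phi_tilde n \<phi>) - ereal \<epsilon> \<le> maximin n (Phi_tilde n \<phi>)"
    by (metis ereal_dense2 linorder_not_less)
  then show "minimax n (Phi_tilde n \<phi>) \<le> maximin n (Phi_tilde n \<phi>) + ereal \<epsilon>"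
    by (cases "minimax n (Phi_tilde n \<phi>)"; cases "maximin n (Phi_tilde n \<phi>)") auto
qed

theorem theorem1:
  fixes Pd :: "'x measure" and Pz :: "'z measure"
    and f :: "real \<Rightarrow> ereal"
    and D :: "real ^ 't::finite \<Rightarrow> 'x \<Rightarrow> real"
    and G :: "real ^ 'g::finite \<Rightarrow> 'z \<Rightarrow> 'x"
    and I :: nat and \<epsilon> :: real
  defines "\<phi> \<equiv> gan_payoff Pd Pz f D G"
  assumes "prob_space Pd" and "prob_space Pz"
    and "\<And>\<theta>. D \<theta> \<in> borel_measurable Pd"
    and "\<And>\<theta> x. x \<in> space Pd \<Longrightarrow> D \<theta> x \<in> {0..1}"
    and "\<And>\<gamma>. G \<gamma> \<in> measurable Pz Pd"
    and "concave_on_ereal {0..1} f" and "mono_on {0..1} f"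
    and "\<epsilon> > 0" and "I > 0"
    and "\<And>i. i \<in> {1..I} \<Longrightarrow> continuous_on (edom (h_fun \<phi> i)) (h_fun \<phi> i)"
    and "\<And>i. i \<in> {1..I} \<Longrightarrow> compact (edom (h_fun \<phi> i))"
    and "\<And>i. i \<in> {1..I} \<Longrightarrow> convex (edom (h_fun \<phi> i))"
    and "ereal (real I) > ereal ((real CARD('t) + 1) / \<epsilon>) * Delta_gamma_worst I \<phi>"
  shows "0 \<le> w_star I \<phi> - q_star I \<phi> \<and>
    w_star I \<phi> - q_star I \<phi> \<le> Delta_theta_minimax I \<phi> + Delta_theta_maximin I \<phi> + ereal \<epsilon>"
proof
  show "0 \<le> w_star I \<phi> - q_star I \<phi>"
    unfolding w_star_def q_star_def by (intro ereal_diff_positive maximin_le_minimax)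
next
  have 1: "1 \<in> {1..I}" using \<open>I > 0\<close> by simp
  obtain C where C: "\<And>\<gamma> \<theta>. \<phi> \<gamma> \<theta> \<le> ereal C"
    using gan_payoff_bounded_above[of Pd Pz D G f] assms(2,3,5-8) unfolding \<phi>_def by blast
  have "Delta_gamma_worst I \<phi> = (MAX i\<in>{1..I}. Delta_gamma \<phi> 1)"
  proof -
    have "Delta_gamma \<phi> i = Delta_gamma \<phi> 1" for i
      by (simp only: Delta_gamma_def h_fun_index[of \<phi> i 1])
    then show ?thesis unfolding Delta_gamma_worst_def
      by (intro arg_cong[of _ _ Max] image_cong refl)
  qed
  also have "\<dots> = Delta_gamma \<phi> 1" by (subst image_constant[OF 1]) (rule Max_singleton)
  finally have "ereal ((real CARD('t) + 1) / \<epsilon>) * Delta_gamma \<phi> 1 < ereal (real I)"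
    using assms(14) by simp
  note tilde = minimax_le_maximin_Phi_tilde[OF C \<open>I > 0\<close> \<open>\<epsilon> > 0\<close>
    assms(12,13,11)[OF 1] this]
  define w q w' q' where "w = minimax I (Phi I \<phi>)" "q = maximin I (Phi I \<phi>)"
    "w' = minimax I (Phi_tilde I \<phi>)" "q' = maximin I (Phi_tilde I \<phi>)"
  note defs = w_q_w'_q'_def
  have "q \<le> w" "q' \<le> w'" "w \<le> w'" "q \<le> q'" "w' \<le> q' + ereal \<epsilon>" "w' < \<infinity>"
    unfolding defs using tilde
    by (auto intro: maximin_le_minimax minimax_mono maximin_mono Phi_le_Phi_tilde)
  \<comment> \<open>For finite values this telescopes through \<open>w'\<close> and
    \<open>q'\<close>, with the middle difference at most \<open>\<epsilon>\<close>; the cases treat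
    the infinite values.\<close>
  then have "w - q \<le> (w - w') + (q' - q) + ereal \<epsilon>"
    by (cases w; cases q; cases w'; cases q') auto
  then show "w_star I \<phi> - q_star I \<phi>
      \<le> Delta_theta_minimax I \<phi> + Delta_theta_maximin I \<phi> + ereal \<epsilon>"
    unfolding w_star_def q_star_def Delta_theta_minimax_def Delta_theta_maximin_def defs .
qed

end
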